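(* Let $H \subset S^{d-1}$ be a finite set of directions, not contained in any closed half-sphere, for which the family of $H$-convex sets is closed under Minkowski sum. Let $\mathcal{F}$ be a finite family of convex sets in $\mathbb{R}^d$. If the intersection of every $|H|$ or fewer sets of $\mathcal{F}$ contains an $H$-convex set of diameter at least one, then $\bigcap \mathcal{F}$ contains an $H$-convex set of diameter at least $|H|^{-1/2}$.
   Context: $S^{d-1}$ is the unit sphere in $\mathbb{R}^d$. An $H$-halfspace is a set $\{y : \langle y, h\rangle \le \lambda\}$ with $h \in H$, $\lambda \in \mathbb{R}$; a set is $H$-convex if it is an intersection of $H$-halfspaces. Diameter is Euclidean. *)

theory Defs
  imports "HOL-Analysis.Analysis" "HOL-Library.Set_Algebras"
begin

definition closed_half_sphere :: "'a::euclidean_space \<Rightarrow> 'a set" where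
  "closed_half_sphere v = {x \<in> sphere 0 1. 0 \<le> v \<bullet> x}"

definition H_halfspace :: "'a::euclidean_space set \<Rightarrow> 'a set \<Rightarrow> bool" where
  "H_halfspace H S \<longleftrightarrow> (\<exists>h\<in>H. \<exists>l::real. S = {y. y \<bullet> h \<le> l})"

text \<open>The empty intersection is allowed, so the whole space is \<open>H\<close>-convex; this is needed
  for closure under Minkowski sums as soon as \<open>H\<close> contains two opposite directions.\<close>

definition H_convex :: "'a::euclidean_space set \<Rightarrow> 'a set \<Rightarrow> bool" where
  "H_convex H K \<longleftrightarrow> (\<exists>\<H>. (\<forall>S\<in>\<H>. H_halfspace H S) \<and> K = \<Inter>\<H>)"

definition minkowski_closed :: "'a::euclidean_space set \<Rightarrow> bool" where
  "minkowski_closed H \<longleftrightarrow> (\<forall>A B. H_convex H A \<longrightarrow> H_convex H B \<longrightarrow> H_convex H (A + B))"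

text \<open>The library's real-valued \<^const>\<open>diameter\<close> is unspecified on unbounded sets, and \<open>H\<close>-convex
  sets may be unbounded; hence the extended-valued diameter, which agrees with it on
  bounded sets and is infinite on unbounded ones.\<close>

definition ediameter :: "'a::metric_space set \<Rightarrow> ennreal" where
  "ediameter S = (SUP (x, y) \<in> S \<times> S. ennreal (dist x y))"

lemma ediameter_bounded:
  assumes "bounded S"
  shows "ediameter S = ennreal (diameter S)"
proof (rule antisym)
  show "ediameter S \<le> ennreal (diameter S)"
    unfolding ediameter_def
    by (rule SUP_least) (auto intro!: ennreal_leI diameter_bounded_bound[OF assms])
  show "ennreal (diameter S) \<le> ediameter S"
  proof (rule ccontr)
    assume "\<not> ?thesis"
    then have lt: "ediameter S < ennreal (diameter S)" by simp
    then obtain r where r: "0 \<le> r" "ediameter S = ennreal r"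
      by (cases "ediameter S") auto
    with lt have "r < diameter S" by (simp add: ennreal_less_iff)
    then have "0 < (r + diameter S) / 2" "(r + diameter S) / 2 < diameter S"
      using r(1) by auto
    then obtain x y where "x \<in> S" "y \<in> S" "(r + diameter S) / 2 < dist x y"
      using diameter_lower_bounded[OF assms] by blast
    with \<open>r < diameter S\<close> have xy: "x \<in> S" "y \<in> S" "r < dist x y" by auto
    have "ennreal (dist x y) \<le> ediameter S"
      unfolding ediameter_def using xy by (intro SUP_upper2[of "(x, y)"]) auto
    with r xy(3) show False by (simp add: ennreal_le_iff)
  qed
qed

lemma ediameter_unbounded:
  assumes "\<not> bounded S"
  shows "ediameter S = \<infinity>"
proof (rule ccontr)
  assume "ediameter S \<noteq> \<infinity>"
  then obtain r where r: "0 \<le> r" "ediameter S = ennreal r"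
    by (cases "ediameter S") auto
  have "dist x y \<le> r" if "x \<in> S" "y \<in> S" for x y
  proof -
    have "ennreal (dist x y) \<le> ediameter S"
      unfolding ediameter_def using that by (intro SUP_upper2[of "(x, y)"]) auto
    with r show ?thesis by (simp add: ennreal_le_iff)
  qed
  then have "bounded S" using bounded_two_points by blast
  with assms show False by simp
qed

end

theory Submission
  imports Defs
begin

text \<open>
  Since \<open>H\<close> positively spans the space, a compact \<open>H\<close>-convex set is determined by the \<open>n = card H\<close>
  values of its support function on \<open>H\<close>, and Minkowski closure makes these values additive. Compact
  \<open>H\<close>-convex sets thus form a convex cone in an \<open>n\<close>-dimensional space, and Helly's theorem holds for
  them with Helly number \<open>n + 1\<close>.

  For each subfamily of at most \<open>n\<close> members choose a compact \<open>H\<close>-convex set of diameter at least one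
  in its intersection. Apply the Helly theorem to the classes of \<open>H\<close>-convex subsets of \<open>A\<close>, for
  \<open>A\<close> in the family, together with one extra class: the convex combinations of the chosen
  sets. If the extra class is among \<open>n + 1\<close> classes, a chosen set is a common member; if not, a single
  point of the intersection of the family is, which exists by the classical Helly theorem
  as \<open>n\<close> exceeds the dimension. Hence the intersection contains a convex combination of sets of diameter
  at least one. Caratheodory's theorem for cones cuts it down to \<open>n\<close> summands without decreasing
  the sum of the coefficients. Let \<open>v j\<close> be a diameter vector of the \<open>j\<close>-th summand, scaled by its coefficient:
  for a suitable choice of signs the squared norm of \<open>\<plusminus>v 1 \<plusminus> \<dots> \<plusminus> v n\<close> is at least the sum of the
  squared norms, which is at least \<open>1 / n\<close>.
\<close>

section \<open>Linear relations and Caratheodory's theorem for cones\<close>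

text \<open>Gaussian elimination, by induction on the coordinate set \<open>H\<close>: a coordinate
  that vanishes on all vectors is dropped; otherwise a pivot vector clears it from the others and is
  itself set aside.\<close>

lemma nontrivial_linear_relation:
  fixes f :: "'j \<Rightarrow> 'h \<Rightarrow> real"
  assumes "finite H" and "finite J" and "card H < card J"
  shows "\<exists>a. (\<exists>j\<in>J. a j \<noteq> 0) \<and> (\<forall>h\<in>H. (\<Sum>j\<in>J. a j * f j h) = 0)"
  using assms
proof (induction H arbitrary: J f rule: finite_induct)
  case empty
  then have "J \<noteq> {}" by auto
  then show ?case by (intro exI[of _ "\<lambda>_. 1"]) auto
next
  case (insert x H)
  show ?case
  proof (cases "\<forall>j\<in>J. f j x = 0")
    case True
    have "card H < card J" using insert by simp
    then obtain a where "\<exists>j\<in>J. a j \<noteq> 0" "\<forall>h\<in>H. (\<Sum>j\<in>J. a j * f j h) = 0"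
      using insert.IH[of J f] insert.prems by blast
    with True show ?thesis by (intro exI[of _ a]) auto
  next
    case False
    then obtain k where k: "k \<in> J" "f k x \<noteq> 0" by auto
    define g where "g j h = f j h - f j x / f k x * f k h" for j h
    have "card H < card (J - {k})" "finite (J - {k})" using insert k by auto
    then obtain a where a: "\<exists>j\<in>J - {k}. a j \<noteq> 0"
      "\<forall>h\<in>H. (\<Sum>j\<in>J - {k}. a j * g j h) = 0"
      using insert.IH[of "J - {k}" g] by blast
    define s where "s = (\<Sum>j\<in>J - {k}. a j * f j x / f k x)"
    \<comment> \<open>This coefficient of the pivot collects what the elimination subtracted, so the
      relation among the \<open>g j\<close> becomes one among the \<open>f j\<close>.\<close>
    define b where "b = a(k := - s)"
    have split: "(\<Sum>j\<in>J. b j * f j h) = (\<Sum>j\<in>J - {k}. a j * g j h)" for h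
    proof -
      have "(\<Sum>j\<in>J. b j * f j h) = - s * f k h + (\<Sum>j\<in>J - {k}. a j * f j h)"
        using insert.prems k by (simp add: sum.remove[of J k] b_def)
      also have "\<dots> = (\<Sum>j\<in>J - {k}. a j * g j h)"
        by (simp add: g_def s_def right_diff_distrib sum_subtractf sum_distrib_right mult.assoc)
      finally show ?thesis .
    qed
    have "(\<Sum>j\<in>J - {k}. a j * g j x) = 0" using k by (simp add: g_def)
    moreover have "\<exists>j\<in>J. b j \<noteq> 0" using a(1) by (auto simp: b_def)
    ultimately show ?thesis using a(2) split by (intro exI[of _ b]) auto
  qed
qed

text \<open>While there are more than \<open>card H\<close> summands, a linear relation moves the
  coefficients until one vanishes. The third hypothesis, that the generators span a pointed cone,
  ensures that this still works when the direction is fixed so as not to lower the coefficient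
  sum.\<close>

lemma caratheodory_cone:
  fixes f :: "'j \<Rightarrow> 'h \<Rightarrow> real"
  assumes "finite H" and "finite J"
    and "\<And>a. (\<And>j. j \<in> J \<Longrightarrow> 0 \<le> a j) \<Longrightarrow> (\<And>h. h \<in> H \<Longrightarrow> (\<Sum>j\<in>J. a j * f j h) = 0) \<Longrightarrow>
           \<forall>j\<in>J. a j = 0"
    and "\<And>j. j \<in> J \<Longrightarrow> 0 \<le> c j"
  shows "\<exists>I b. I \<subseteq> J \<and> card I \<le> card H \<and> (\<forall>j\<in>I. 0 \<le> b j) \<and> sum c J \<le> sum b I \<and>
           (\<forall>h\<in>H. (\<Sum>j\<in>I. b j * f j h) = (\<Sum>j\<in>J. c j * f j h))"
  using assms(2-)
proof (induction "card J" arbitrary: J c rule: less_induct)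
  case less
  note pointed = less.prems(2)
  show ?case
  proof (cases "card J \<le> card H")
    case True
    then show ?thesis using less.prems(3) by (intro exI[of _ J] exI[of _ c]) auto
  next
    case False
    then obtain a0 where a0: "\<exists>j\<in>J. a0 j \<noteq> 0" "\<forall>h\<in>H. (\<Sum>j\<in>J. a0 j * f j h) = 0"
      using nontrivial_linear_relation[OF assms(1) less.prems(1), of f] by auto
    \<comment> \<open>Subtracting nonnegative multiples of this orientation cannot decrease the sum
      of the coefficients.\<close>
    define a where "a = (if sum a0 J \<le> 0 then a0 else (\<lambda>j. - a0 j))"
    have a: "\<exists>j\<in>J. a j \<noteq> 0" "\<forall>h\<in>H. (\<Sum>j\<in>J. a j * f j h) = 0" "sum a J \<le> 0"
      using a0 by (auto simp: a_def sum_negf)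
    define P where "P = {j\<in>J. 0 < a j}"
    have "P \<noteq> {}"
    proof
      assume "P = {}"
      then have "\<And>j. j \<in> J \<Longrightarrow> 0 \<le> - a j" by (force simp: P_def)
      moreover have "\<And>h. h \<in> H \<Longrightarrow> (\<Sum>j\<in>J. - a j * f j h) = 0" using a(2) by (simp add: sum_negf)
      ultimately have "\<forall>j\<in>J. - a j = 0" by (rule pointed)
      with a(1) show False by auto
    qed
    moreover have "finite P" using less.prems(1) by (simp add: P_def)
    ultimately obtain k where k: "k \<in> P" and kmin: "\<And>j. j \<in> P \<Longrightarrow> c k / a k \<le> c j / a j"
      using arg_min_if_finite(1) arg_min_least[of P _ "\<lambda>j. c j / a j"] by metis
    \<comment> \<open>The largest multiple of \<open>a\<close> that can be subtracted with all
      coefficients staying nonnegative; it annihilates the one at \<open>k\<close>.\<close>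
    define s where "s = c k / a k"
    define b where "b j = c j - s * a j" for j
    have s0: "0 \<le> s" using k less.prems(3) by (auto simp: s_def P_def)
    have b0: "0 \<le> b j" if "j \<in> J" for j
    proof (cases "j \<in> P")
      case True
      then show ?thesis using kmin[OF True] by (auto simp: b_def s_def P_def field_simps)
    next
      case False
      then have "s * a j \<le> 0" using s0 that by (auto simp: P_def mult_le_0_iff)
      then show ?thesis using less.prems(3)[OF that] by (simp add: b_def)
    qed
    have bk: "b k = 0" "k \<in> J" using k by (auto simp: b_def s_def P_def)
    have drop: "(\<Sum>j\<in>J - {k}. b j * r j) = (\<Sum>j\<in>J. c j * r j) - s * (\<Sum>j\<in>J. a j * r j)" for r
    proof -
      have "(\<Sum>j\<in>J. b j * r j) = (\<Sum>j\<in>J - {k}. b j * r j)"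
        using less.prems(1) bk by (simp add: sum.remove[of J k])
      then show ?thesis
        by (simp add: b_def left_diff_distrib sum_subtractf sum_distrib_left mult.assoc)
    qed
    have smaller: "card (J - {k}) < card J"
      using less.prems(1) bk(2) by (meson card_Diff1_less)
    have pointed': "\<forall>j\<in>J - {k}. e j = 0"
      if e: "\<And>j. j \<in> J - {k} \<Longrightarrow> 0 \<le> e j" "\<And>h. h \<in> H \<Longrightarrow> (\<Sum>j\<in>J - {k}. e j * f j h) = 0" for e
    proof -
      have "(\<Sum>j\<in>J. (e(k := 0)) j * f j h) = (\<Sum>j\<in>J - {k}. e j * f j h)" for h
        using less.prems(1) bk(2) by (simp add: sum.remove[of J k])
      then have "\<forall>j\<in>J. (e(k := 0)) j = 0" using e by (intro pointed) auto
      then show ?thesis by (metis DiffE fun_upd_other insertCI)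
    qed
    obtain I d where I: "I \<subseteq> J - {k}" "card I \<le> card H" "\<forall>j\<in>I. 0 \<le> d j"
      "sum b (J - {k}) \<le> sum d I"
      "\<forall>h\<in>H. (\<Sum>j\<in>I. d j * f j h) = (\<Sum>j\<in>J - {k}. b j * f j h)"
      using less.hyps[OF smaller _ pointed', of b] less.prems(1) b0 by blast
    have "sum c J \<le> sum b (J - {k})"
      using drop[of "\<lambda>_. 1"] a(3) s0 by (simp add: mult_nonneg_nonpos)
    then show ?thesis using I drop a(2) by (intro exI[of _ I] exI[of _ d]) auto
  qed
qed

section \<open>Signed sums, Minkowski combinations and their diameter\<close>

text \<open>Signs are chosen greedily: each new one makes the inner product with the partial sum
  nonnegative, so the cross term only helps.\<close>

lemma sign_choice_norm_sum_ge:
  fixes v :: "'j \<Rightarrow> 'a::real_inner"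
  assumes "finite J"
  shows "\<exists>e. (\<forall>j. e j = 1 \<or> e j = -1) \<and> (\<Sum>j\<in>J. (norm (v j))\<^sup>2) \<le> (norm (\<Sum>j\<in>J. e j *\<^sub>R v j))\<^sup>2"
  using assms
proof induction
  case empty
  then show ?case by (auto intro: exI[of _ "\<lambda>_. 1"])
next
  case (insert k J)
  then obtain e :: "'j \<Rightarrow> real" where e: "\<And>j. e j = 1 \<or> e j = -1"
    "(\<Sum>j\<in>J. (norm (v j))\<^sup>2) \<le> (norm (\<Sum>j\<in>J. e j *\<^sub>R v j))\<^sup>2" by blast
  define w where "w = (\<Sum>j\<in>J. e j *\<^sub>R v j)"
  define t :: real where "t = (if 0 \<le> v k \<bullet> w then 1 else -1)"
  have t: "t = 1 \<or> t = -1" "0 \<le> t * (v k \<bullet> w)" by (auto simp: t_def)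
  have sum: "(\<Sum>j\<in>insert k J. (e(k := t)) j *\<^sub>R v j) = t *\<^sub>R v k + w"
    using insert.hyps by (auto simp: w_def intro!: sum.cong)
  have "(norm (t *\<^sub>R v k + w))\<^sup>2 = (norm (v k))\<^sup>2 + 2 * (t * (v k \<bullet> w)) + (norm w)\<^sup>2"
    using t(1) by (auto simp: power2_norm_eq_inner inner_commute algebra_simps)
  then have "(\<Sum>j\<in>insert k J. (norm (v j))\<^sup>2) \<le> (norm (t *\<^sub>R v k + w))\<^sup>2"
    using e(2) t(2) insert.hyps by (simp add: w_def)
  then show ?case using e(1) t(1) sum by (intro exI[of _ "e(k := t)"]) auto
qed

text \<open>The Minkowski combination of the sets \<open>M j\<close> with coefficients
  \<open>c j\<close>, which is \<open>{0}\<close> for empty \<open>J\<close>. Choosing one point per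
  set gives direct access to its elements.\<close>

definition mix :: "'j set \<Rightarrow> ('j \<Rightarrow> real) \<Rightarrow> ('j \<Rightarrow> 'a::real_vector set) \<Rightarrow> 'a set" where
  "mix J c M = {(\<Sum>j\<in>J. c j *\<^sub>R x j) | x. \<forall>j\<in>J. x j \<in> M j}"

lemma mix_memI: "(\<And>j. j \<in> J \<Longrightarrow> x j \<in> M j) \<Longrightarrow> (\<Sum>j\<in>J. c j *\<^sub>R x j) \<in> mix J c M"
  unfolding mix_def by blast

lemma mix_insert:
  assumes "finite J" and "k \<notin> J"
  shows "mix (insert k J) c M = (*\<^sub>R) (c k) ` M k + mix J c M"
proof (intro set_eqI iffI)
  fix y assume "y \<in> mix (insert k J) c M"
  then obtain x where "y = (\<Sum>j\<in>insert k J. c j *\<^sub>R x j)" "\<forall>j\<in>insert k J. x j \<in> M j"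
    by (auto simp: mix_def)
  then show "y \<in> (*\<^sub>R) (c k) ` M k + mix J c M"
    using assms by (auto intro!: mix_memI)
next
  fix y assume "y \<in> (*\<^sub>R) (c k) ` M k + mix J c M"
  then obtain z x where zx: "z \<in> M k" "\<forall>j\<in>J. x j \<in> M j" "y = c k *\<^sub>R z + (\<Sum>j\<in>J. c j *\<^sub>R x j)"
    by (auto simp: mix_def elim!: set_plus_elim)
  have "(\<Sum>j\<in>insert k J. c j *\<^sub>R (x(k := z)) j) \<in> mix (insert k J) c M"
    using zx by (intro mix_memI) auto
  moreover have "(\<Sum>j\<in>J. c j *\<^sub>R (if j = k then z else x j)) = (\<Sum>j\<in>J. c j *\<^sub>R x j)"
    using assms(2) by (intro sum.cong) auto
  ultimately show "y \<in> mix (insert k J) c M" using zx(3) assms by simp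
qed

lemma mix_subset_convex:
  assumes "convex A" and "finite J" and "\<And>j. j \<in> J \<Longrightarrow> 0 \<le> c j" and "sum c J = 1"
    and "\<And>j. j \<in> J \<Longrightarrow> M j \<subseteq> A"
  shows "mix J c M \<subseteq> A"
  using assms by (auto simp: mix_def intro!: convex_sum)

text \<open>The scaled difference vectors have norms of sum at least one, so by Cauchy-Schwarz their
  squared norms sum to at least \<open>1 / n\<close>; suitable signs turn this into a
  distance.\<close>

lemma dist_mix_ge:
  fixes M :: "'j \<Rightarrow> 'a::real_inner set"
  assumes "finite J" and "card J \<le> n" and "\<And>j. j \<in> J \<Longrightarrow> 0 \<le> c j" and "1 \<le> sum c J"
    and "\<And>j. j \<in> J \<Longrightarrow> x j \<in> M j \<and> y j \<in> M j \<and> 1 \<le> dist (x j) (y j)"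
  shows "\<exists>p\<in>mix J c M. \<exists>q\<in>mix J c M. real n powr (- 1 / 2) \<le> dist p q"
proof -
  define v where "v j = c j *\<^sub>R (x j - y j)" for j
  obtain e :: "'j \<Rightarrow> real" where e: "\<And>j. e j = 1 \<or> e j = -1"
    "(\<Sum>j\<in>J. (norm (v j))\<^sup>2) \<le> (norm (\<Sum>j\<in>J. e j *\<^sub>R v j))\<^sup>2"
    using sign_choice_norm_sum_ge[OF assms(1), of v] by blast
  \<comment> \<open>A negative sign is realised by swapping the endpoints \<open>x j\<close> and
    \<open>y j\<close>, so the signed sum is a difference of two points of the combination.\<close>
  define p q where "p = (\<Sum>j\<in>J. c j *\<^sub>R (if e j = 1 then x j else y j))"
    and "q = (\<Sum>j\<in>J. c j *\<^sub>R (if e j = 1 then y j else x j))"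
  have pq: "p \<in> mix J c M" "q \<in> mix J c M"
    unfolding p_def q_def using assms(5) by (auto intro!: mix_memI)
  have "e j *\<^sub>R v j = c j *\<^sub>R (if e j = 1 then x j else y j) - c j *\<^sub>R (if e j = 1 then y j else x j)" for j
    using e(1)[of j] by (auto simp: v_def algebra_simps)
  then have "(\<Sum>j\<in>J. e j *\<^sub>R v j) = p - q"
    unfolding p_def q_def sum_subtractf[symmetric] by (intro sum.cong) auto
  then have d: "(\<Sum>j\<in>J. (norm (v j))\<^sup>2) \<le> (dist p q)\<^sup>2" using e(2) by (simp add: dist_norm)
  have n0: "0 < n" using assms by (cases "J = {}") (auto simp: card_gt_0_iff intro: less_le_trans)
  have "c j \<le> norm (v j)" if "j \<in> J" for j
    using assms(3,5)[OF that] mult_left_mono[of 1 "dist (x j) (y j)" "c j"]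
    by (simp add: v_def dist_norm)
  then have "1 \<le> (\<Sum>j\<in>J. norm (v j))"
    using assms(4) sum_mono[of J c "\<lambda>j. norm (v j)"] by force
  then have "1 \<le> (\<Sum>j\<in>J. norm (v j))\<^sup>2" by (simp add: one_le_power)
  also have "\<dots> \<le> (\<Sum>j\<in>J. (norm (v j))\<^sup>2) * (\<Sum>j\<in>J. 1\<^sup>2)"
    using Cauchy_Schwarz_ineq_sum[of "\<lambda>j. norm (v j)" "\<lambda>_. 1" J] by simp
  also have "\<dots> \<le> (dist p q)\<^sup>2 * real n"
    using d assms(2) by (intro mult_mono) auto
  finally have "1 / real n \<le> (dist p q)\<^sup>2" using n0 by (simp add: field_simps)
  then have "sqrt (1 / real n) \<le> dist p q" by (simp add: real_le_lsqrt)
  moreover have "real n powr (- 1 / 2) = sqrt (1 / real n)"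
    using n0 by (simp add: powr_minus powr_half_sqrt real_sqrt_divide inverse_eq_divide
        flip: minus_divide_left)
  ultimately show ?thesis using pq by metis
qed

section \<open>Compact \<open>H\<close>-convex sets and their support functions\<close>

locale minkowski_directions =
  fixes H :: "'a::euclidean_space set"
  assumes finite_H: "finite H"
    and positively_spanning: "v \<noteq> 0 \<Longrightarrow> \<exists>h\<in>H. 0 < v \<bullet> h"
    and minkowski: "minkowski_closed H"
begin

text \<open>Since \<open>H\<close>-convex sets are closed, boundedness already gives
  compactness.\<close>

definition body :: "'a set \<Rightarrow> bool" where
  "body K \<longleftrightarrow> H_convex H K \<and> K \<noteq> {} \<and> bounded K"

definition supp :: "'a set \<Rightarrow> 'a \<Rightarrow> real" where
  "supp K h = (SUP y\<in>K. y \<bullet> h)"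

text \<open>Even after removal of one direction \<open>k\<close> the rest spans: a vector
  \<open>v\<close> orthogonal to the rest would, up to sign, have no positive inner product with any
  element of \<open>H\<close>.\<close>

lemma DIM_less_card: "DIM('a) < card H"
proof -
  obtain b :: 'a where "b \<in> Basis" using nonempty_Basis by blast
  then obtain k where k: "k \<in> H" using positively_spanning[of b] nonzero_Basis by blast
  have "span (H - {k}) = UNIV"
  proof (rule ccontr)
    assume "span (H - {k}) \<noteq> UNIV"
    then obtain v where v: "v \<noteq> 0" "\<And>x. x \<in> span (H - {k}) \<Longrightarrow> v \<bullet> x = 0"
      using span_not_UNIV_orthogonal by blast
    define w where "w = (if 0 \<le> v \<bullet> k then - v else v)"
    have "w \<noteq> 0" using v(1) by (simp add: w_def)
    then obtain h where h: "h \<in> H" "0 < w \<bullet> h" using positively_spanning by blast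
    have "h = k"
    proof (rule ccontr)
      assume "h \<noteq> k"
      then have "v \<bullet> h = 0" using h(1) by (intro v(2) span_base) auto
      with h(2) show False by (simp add: w_def split: if_splits)
    qed
    with h show False by (auto simp: w_def split: if_splits)
  qed
  then have "DIM('a) \<le> card (H - {k})"
    using dim_le_card[of UNIV "H - {k}"] finite_H by simp
  then show ?thesis using k finite_H by (meson card_Diff1_less le_less_trans)
qed

text \<open>The sum \<open>m\<close> of positive parts is positively homogeneous and has a positive
  minimum on the unit sphere, so it dominates a multiple of the norm.\<close>

lemma bounded_truncation: "bounded {y. \<forall>h\<in>H. y \<bullet> h \<le> R}"
proof -
  define m where "m v = (\<Sum>h\<in>H. max 0 (v \<bullet> h))" for v
  have "continuous_on (sphere 0 1) m" unfolding m_def by (intro continuous_intros)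
  moreover have "sphere (0::'a) 1 \<noteq> {}" by simp
  ultimately obtain u where u: "u \<in> sphere 0 1" "\<And>v. v \<in> sphere 0 1 \<Longrightarrow> m u \<le> m v"
    using continuous_attains_inf[OF compact_sphere] by metis
  obtain h where h: "h \<in> H" "0 < u \<bullet> h" using positively_spanning[of u] u(1) by force
  have "max 0 (u \<bullet> h) \<le> m u" unfolding m_def using h(1) finite_H by (intro member_le_sum) auto
  with h(2) have m0: "0 < m u" by simp
  have "norm y \<le> real (card H) * \<bar>R\<bar> / m u" if y: "\<forall>h\<in>H. y \<bullet> h \<le> R" for y
  proof (cases "y = 0")
    case False
    have "max 0 (y \<bullet> h) = norm y * max 0 ((y /\<^sub>R norm y) \<bullet> h)" for h
      using False by (auto simp: max_def zero_le_mult_iff divide_simps)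
    then have "m y = norm y * m (y /\<^sub>R norm y)"
      unfolding m_def by (simp add: sum_distrib_left)
    moreover have "m u \<le> m (y /\<^sub>R norm y)" using False by (intro u(2)) auto
    ultimately have "norm y * m u \<le> m y" by (simp add: mult_left_mono)
    also have "m y \<le> (\<Sum>h\<in>H. \<bar>R\<bar>)" unfolding m_def using y by (intro sum_mono) force
    finally show ?thesis using m0 by (simp add: field_simps)
  qed (use m0 in auto)
  then show ?thesis unfolding bounded_iff by blast
qed

lemma closed_H_convex: "H_convex H K \<Longrightarrow> closed K"
  by (auto simp: H_convex_def H_halfspace_def intro!: closed_Inter closed_Collect_le continuous_intros)

lemma H_convex_halfspaces: "H_convex H {y. \<forall>h\<in>H. y \<bullet> h \<le> l h}"
  unfolding H_convex_def
  by (intro exI[of _ "(\<lambda>h. {y. y \<bullet> h \<le> l h}) ` H"]) (auto simp: H_halfspace_def)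

lemma H_convex_Int: "H_convex H K \<Longrightarrow> H_convex H L \<Longrightarrow> H_convex H (K \<inter> L)"
  unfolding H_convex_def by (metis Inter_Un_distrib Un_iff)

lemma supp_upper: "body K \<Longrightarrow> y \<in> K \<Longrightarrow> y \<bullet> h \<le> supp K h"
  unfolding supp_def body_def
  by (intro cSUP_upper bounded_imp_bdd_above bounded_linear_image bounded_linear_inner_left) auto

lemma supp_attained:
  assumes "body K"
  obtains y where "y \<in> K" "supp K h = y \<bullet> h"
proof -
  have "compact K" "K \<noteq> {}"
    using assms closed_H_convex by (auto simp: body_def compact_eq_bounded_closed)
  then obtain y where y: "y \<in> K" "\<And>z. z \<in> K \<Longrightarrow> z \<bullet> h \<le> y \<bullet> h"
    using continuous_attains_sup[of K "\<lambda>z. z \<bullet> h"] continuous_on_inner[OF continuous_on_id continuous_on_const]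
    by blast
  then have "supp K h = y \<bullet> h" unfolding supp_def by (intro cSup_eq_maximum) auto
  with y(1) that show thesis by blast
qed

text \<open>Each halfspace in a representation of \<open>K\<close> contains the supporting halfspace
  with the same normal, because the supremum is attained in \<open>K\<close>.\<close>

lemma body_eq_halfspaces:
  assumes "body K"
  shows "K = {y. \<forall>h\<in>H. y \<bullet> h \<le> supp K h}"
proof (intro set_eqI iffI)
  fix y assume y: "y \<in> {y. \<forall>h\<in>H. y \<bullet> h \<le> supp K h}"
  obtain \<H> where \<H>: "\<forall>S\<in>\<H>. H_halfspace H S" "K = \<Inter>\<H>"
    using assms by (auto simp: body_def H_convex_def)
  have "y \<in> S" if S: "S \<in> \<H>" for S
  proof -
    obtain h l where h: "h \<in> H" "S = {y. y \<bullet> h \<le> l}"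
      using \<H>(1) S by (auto simp: H_halfspace_def)
    obtain z where "z \<in> K" "supp K h = z \<bullet> h" using supp_attained[OF assms] by blast
    then have "supp K h \<le> l" using h \<H>(2) S by auto
    then show ?thesis using y h by force
  qed
  then show "y \<in> K" using \<H>(2) by blast
qed (use assms supp_upper in auto)

lemma body_eqI:
  assumes "body K" "body L" and "\<And>h. h \<in> H \<Longrightarrow> supp K h = supp L h"
  shows "K = L"
  using body_eq_halfspaces[OF assms(1)] body_eq_halfspaces[OF assms(2)] assms(3) by auto

text \<open>If no direction separates \<open>y\<close> from \<open>p\<close>, then
  \<open>y - p\<close> has no positive inner product with \<open>H\<close> and must vanish.\<close>

lemma body_singleton: "body {p}"
proof -
  have "{p} = {y. \<forall>h\<in>H. y \<bullet> h \<le> p \<bullet> h}"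
    using positively_spanning[of "_ - p"] by (force simp: inner_diff_left)
  then have "H_convex H {p}" using H_convex_halfspaces[of "\<lambda>h. p \<bullet> h"] by simp
  then show ?thesis by (simp add: body_def)
qed

lemma body_scale:
  assumes "body K" and "0 \<le> t"
  shows "body ((*\<^sub>R) t ` K)"
proof (cases "t = 0")
  case True
  then have "(*\<^sub>R) t ` K = {0}" using assms(1) by (auto simp: body_def)
  then show ?thesis using body_singleton by simp
next
  case False
  with assms(2) have t: "0 < t" by simp
  have "(*\<^sub>R) t ` K = {y. \<forall>h\<in>H. y \<bullet> h \<le> t * supp K h}"
  proof (intro set_eqI iffI)
    fix y assume "y \<in> {y. \<forall>h\<in>H. y \<bullet> h \<le> t * supp K h}"
    then have "(1 / t) *\<^sub>R y \<in> K" 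
      using t by (subst body_eq_halfspaces[OF assms(1)]) (auto simp: field_simps)
    then show "y \<in> (*\<^sub>R) t ` K" using t by (intro image_eqI[of _ _ "(1 / t) *\<^sub>R y"]) auto
  qed (use t assms(1) supp_upper in auto)
  then have "H_convex H ((*\<^sub>R) t ` K)" using H_convex_halfspaces[of "\<lambda>h. t * supp K h"] by simp
  then show ?thesis using assms(1) by (auto simp: body_def bounded_scaling)
qed

text \<open>Minkowski closure of the \<open>H\<close>-convex sets enters here, one summand at a
  time.\<close>

lemma body_mix:
  assumes "finite J" and "\<And>j. j \<in> J \<Longrightarrow> body (M j)" and "\<And>j. j \<in> J \<Longrightarrow> 0 \<le> c j"
  shows "body (mix J c M)"
  using assms
proof induction
  case empty
  have "mix {} c M = {0}" by (auto simp: mix_def)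
  then show ?case using body_singleton by simp
next
  case (insert k J)
  have a: "body ((*\<^sub>R) (c k) ` M k)" and b: "body (mix J c M)"
    using insert by (auto intro: body_scale)
  have "bounded ((*\<^sub>R) (c k) ` M k + mix J c M)"
    using bounded_sums[of "(*\<^sub>R) (c k) ` M k" "mix J c M"] a b
    by (auto simp: body_def set_plus_def elim!: bounded_subset)
  then have "body ((*\<^sub>R) (c k) ` M k + mix J c M)"
    using a b minkowski by (auto simp: body_def minkowski_closed_def set_plus_def)
  then show ?case using insert.hyps by (simp add: mix_insert)
qed

lemma supp_mix:
  assumes "finite J" and "\<And>j. j \<in> J \<Longrightarrow> body (M j)" and "\<And>j. j \<in> J \<Longrightarrow> 0 \<le> c j"
  shows "supp (mix J c M) h = (\<Sum>j\<in>J. c j * supp (M j) h)"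
proof (rule antisym)
  have B: "body (mix J c M)" using assms by (rule body_mix)
  obtain y where y: "y \<in> mix J c M" "supp (mix J c M) h = y \<bullet> h" using supp_attained[OF B] by blast
  then obtain x where x: "\<forall>j\<in>J. x j \<in> M j" "y = (\<Sum>j\<in>J. c j *\<^sub>R x j)" by (auto simp: mix_def)
  have "y \<bullet> h = (\<Sum>j\<in>J. c j * (x j \<bullet> h))" by (simp add: x(2) inner_sum_left)
  also have "\<dots> \<le> (\<Sum>j\<in>J. c j * supp (M j) h)"
    using assms x(1) by (intro sum_mono mult_left_mono supp_upper) auto
  finally show "supp (mix J c M) h \<le> (\<Sum>j\<in>J. c j * supp (M j) h)" using y(2) by simp
  have "\<forall>j\<in>J. \<exists>z. z \<in> M j \<and> supp (M j) h = z \<bullet> h"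
    using assms(2) supp_attained by metis
  then obtain z where z: "\<And>j. j \<in> J \<Longrightarrow> z j \<in> M j \<and> supp (M j) h = z j \<bullet> h" by metis
  have "(\<Sum>j\<in>J. c j * supp (M j) h) = (\<Sum>j\<in>J. c j *\<^sub>R z j) \<bullet> h"
    using z by (simp add: inner_sum_left)
  also have "\<dots> \<le> supp (mix J c M) h" using z by (intro supp_upper[OF B] mix_memI) auto
  finally show "(\<Sum>j\<in>J. c j * supp (M j) h) \<le> supp (mix J c M) h" .
qed

text \<open>Equality of two combinations is reduced to \<open>card H\<close> linear equations, which
  makes the linear algebra above applicable to bodies.\<close>

lemma mix_eqI:
  assumes "finite I" "\<And>i. i \<in> I \<Longrightarrow> body (M i)" "\<And>i. i \<in> I \<Longrightarrow> 0 \<le> b i"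
    and "finite J" "\<And>j. j \<in> J \<Longrightarrow> body (N j)" "\<And>j. j \<in> J \<Longrightarrow> 0 \<le> c j"
    and "\<And>h. h \<in> H \<Longrightarrow> (\<Sum>i\<in>I. b i * supp (M i) h) = (\<Sum>j\<in>J. c j * supp (N j) h)"
  shows "mix I b M = mix J c N"
  using assms by (intro body_eqI body_mix) (auto simp: supp_mix)

section \<open>Helly's theorem for classes of bodies\<close>

text \<open>Radon's argument, with bodies in place of points and the classes \<open>\<C> i\<close>
  in place of convex sets. An affine relation among support vectors in \<open>card H\<close>
  coordinates exists once there are \<open>card H + 2\<close> bodies.\<close>

lemma helly_bodies:
  fixes \<C> :: "'i \<Rightarrow> 'a set set"
  assumes "finite I"
    and "\<And>i (J::'i set) c M. i \<in> I \<Longrightarrow> finite J \<Longrightarrow> (\<And>j. j \<in> J \<Longrightarrow> M j \<in> \<C> i) \<Longrightarrow>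
           (\<And>j. j \<in> J \<Longrightarrow> 0 \<le> c j) \<Longrightarrow> sum c J = 1 \<Longrightarrow> mix J c M \<in> \<C> i"
    and "\<And>J. J \<subseteq> I \<Longrightarrow> card J \<le> card H + 1 \<Longrightarrow> \<exists>K. body K \<and> (\<forall>j\<in>J. K \<in> \<C> j)"
  shows "\<exists>K. body K \<and> (\<forall>i\<in>I. K \<in> \<C> i)"
  using assms
proof (induction "card I" arbitrary: I rule: less_induct)
  case less
  note closed = less.prems(2)
  show ?case
  proof (cases "card I \<le> card H + 1")
    case True
    then show ?thesis using less.prems(3) by blast
  next
    case False
    have "\<exists>K. body K \<and> (\<forall>j\<in>I - {i}. K \<in> \<C> j)" if "i \<in> I" for i
    proof (rule less.hyps)
      show "card (I - {i}) < card I" using that less.prems(1) by (meson card_Diff1_less)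
    qed (use less.prems in \<open>auto simp: subset_iff\<close>)
    then obtain K where K: "\<And>i. i \<in> I \<Longrightarrow> body (K i)"
      "\<And>i j. i \<in> I \<Longrightarrow> j \<in> I \<Longrightarrow> j \<noteq> i \<Longrightarrow> K i \<in> \<C> j"
      by (metis Diff_iff singletonD)
    \<comment> \<open>The extra coordinate \<open>None\<close>, constantly 1, forces the
      coefficients of the relation to sum to zero.\<close>
    define f where "f i h = (case h of None \<Rightarrow> 1 | Some h \<Rightarrow> supp (K i) h)" for i h
    have "card (insert None (Some ` H)) < card I" "finite (insert None (Some ` H))"
      using False finite_H by (auto simp: card_insert_if card_image)
    then obtain a where a: "\<exists>i\<in>I. a i \<noteq> 0"
      "\<forall>h\<in>insert None (Some ` H). (\<Sum>i\<in>I. a i * f i h) = 0"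
      using nontrivial_linear_relation[of "insert None (Some ` H)" I f] less.prems(1) by blast
    have a0: "sum a I = 0" and ah: "\<And>h. h \<in> H \<Longrightarrow> (\<Sum>i\<in>I. a i * supp (K i) h) = 0"
      using a(2) by (auto simp: f_def)
    define P where "P = {i\<in>I. 0 < a i}"
    have fin: "finite P" "finite (I - P)" and PI: "P \<subseteq> I"
      using less.prems(1) by (auto simp: P_def)
    have split: "sum g I = sum g P + sum g (I - P)" for g :: "'i \<Rightarrow> real"
      using less.prems(1) PI by (metis add.commute sum.subset_diff)
    define S where "S = sum a P"
    have "P \<noteq> {}"
    proof
      assume "P = {}"
      then have "\<And>i. i \<in> I \<Longrightarrow> 0 \<le> - a i" by (force simp: P_def)
      moreover have "(\<Sum>i\<in>I. - a i) = 0" using a0 by (simp add: sum_negf)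
      ultimately have "\<forall>i\<in>I. - a i = 0" using less.prems(1) sum_nonneg_eq_0_iff[of I "\<lambda>i. - a i"] by blast
      with a(1) show False by auto
    qed
    then have S: "0 < S" unfolding S_def using fin by (intro sum_pos) (auto simp: P_def)
    define X where "X = mix P (\<lambda>i. a i / S) K"
    define Y where "Y = mix (I - P) (\<lambda>i. - a i / S) K"
    have nonneg: "\<And>i. i \<in> P \<Longrightarrow> 0 \<le> a i / S" "\<And>i. i \<in> I - P \<Longrightarrow> 0 \<le> - a i / S"
      using S by (auto simp: P_def divide_simps)
    have one: "(\<Sum>i\<in>P. a i / S) = 1" "(\<Sum>i\<in>I - P. - a i / S) = 1"
      using S a0 split[of a] by (auto simp: S_def sum_negf field_simps simp flip: sum_divide_distrib)
    \<comment> \<open>The Radon body. \<open>K i\<close> can miss only the class of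
      \<open>i\<close>, so \<open>X\<close>, built from indices in \<open>P\<close>, lies in the
      classes outside \<open>P\<close>, and \<open>Y\<close> in those of \<open>P\<close>.\<close>
    have "X = Y" unfolding X_def Y_def
    proof (rule mix_eqI)
      fix h assume "h \<in> H"
      then have "(\<Sum>i\<in>P. a i * supp (K i) h) = - (\<Sum>i\<in>I - P. a i * supp (K i) h)"
        using ah split[of "\<lambda>i. a i * supp (K i) h"] by force
      then show "(\<Sum>i\<in>P. a i / S * supp (K i) h) = (\<Sum>i\<in>I - P. - a i / S * supp (K i) h)"
        by (simp add: sum_negf flip: sum_divide_distrib)
    qed (use fin K PI nonneg in auto)
    moreover have "X \<in> \<C> i" if "i \<in> I - P" for i
      unfolding X_def using that fin K PI nonneg one by (intro closed) auto
    moreover have "Y \<in> \<C> i" if "i \<in> P" for i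
      unfolding Y_def using that fin K PI nonneg one by (intro closed) auto
    moreover have "body X" unfolding X_def using fin K PI nonneg by (intro body_mix) auto
    ultimately show ?thesis by (metis DiffI)
  qed
qed

section \<open>From Helly's theorem to the diameter bound\<close>

text \<open>Two points at distance at least one exist by compactness, or by unboundedness;
  truncation in all directions of \<open>H\<close> keeps both and makes the set bounded.\<close>

lemma body_of_ediameter_ge_1:
  assumes "H_convex H K" and "1 \<le> ediameter K"
  obtains L x y where "body L" "L \<subseteq> K" "x \<in> L" "y \<in> L" "1 \<le> dist x y"
proof -
  have "\<exists>x\<in>K. \<exists>y\<in>K. 1 \<le> dist x y"
  proof (cases "bounded K")
    case True
    have "K \<noteq> {}" using assms(2) by (auto simp: ediameter_def bot_ennreal)
    moreover have "compact K"
      using True closed_H_convex[OF assms(1)] by (simp add: compact_eq_bounded_closed)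
    moreover have "1 \<le> diameter K"
      using assms(2) True by (simp add: ediameter_bounded)
    ultimately show ?thesis using diameter_compact_attained[of K] by metis
  next
    case False
    then show ?thesis using bounded_two_points[of K] by (meson le_cases)
  qed
  then obtain x y where xy: "x \<in> K" "y \<in> K" "1 \<le> dist x y" by blast
  define R where "R = (\<Sum>h\<in>H. \<bar>x \<bullet> h\<bar> + \<bar>y \<bullet> h\<bar>)"
  define L where "L = K \<inter> {z. \<forall>h\<in>H. z \<bullet> h \<le> R}"
  have "\<bar>x \<bullet> h\<bar> + \<bar>y \<bullet> h\<bar> \<le> R" if "h \<in> H" for h
    unfolding R_def using that finite_H by (intro member_le_sum) auto
  then have xyL: "x \<in> L" "y \<in> L" using xy by (fastforce simp: L_def)+
  have "H_convex H L"
    unfolding L_def using assms(1) H_convex_halfspaces[of "\<lambda>_. R"] by (rule H_convex_Int)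
  moreover have "bounded L" unfolding L_def using bounded_truncation by (rule bounded_Int[OF disjI2])
  ultimately have "body L" using xyL by (auto simp: body_def)
  then show thesis using that[of L x y] xyL xy by (auto simp: L_def)
qed

lemma helly_diameter:
  assumes "finite \<F>" and "\<And>A. A \<in> \<F> \<Longrightarrow> convex A"
    and "\<And>\<G>. \<G> \<subseteq> \<F> \<Longrightarrow> card \<G> \<le> card H \<Longrightarrow>
           \<exists>K. H_convex H K \<and> K \<subseteq> \<Inter>\<G> \<and> 1 \<le> ediameter K"
  shows "\<exists>K. H_convex H K \<and> K \<subseteq> \<Inter>\<F> \<and> ennreal (real (card H) powr (- 1 / 2)) \<le> ediameter K"
proof -
  define T where "T = {\<G>. \<G> \<subseteq> \<F> \<and> card \<G> \<le> card H}"
  have finT: "finite T" using assms(1) by (simp add: T_def)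
  have "\<exists>L x y. body L \<and> L \<subseteq> \<Inter>\<G> \<and> x \<in> L \<and> y \<in> L \<and> 1 \<le> dist x y" if \<G>: "\<G> \<in> T" for \<G>
  proof -
    obtain K where "H_convex H K" "K \<subseteq> \<Inter>\<G>" "1 \<le> ediameter K"
      using assms(3) \<G> unfolding T_def by blast
    then show ?thesis by (metis body_of_ediameter_ge_1 subset_trans)
  qed
  then obtain L x y where L: "\<And>\<G>. \<G> \<in> T \<Longrightarrow> body (L \<G>)" "\<And>\<G>. \<G> \<in> T \<Longrightarrow> L \<G> \<subseteq> \<Inter>\<G>"
    and xy: "\<And>\<G>. \<G> \<in> T \<Longrightarrow> x \<G> \<in> L \<G> \<and> y \<G> \<in> L \<G> \<and> 1 \<le> dist (x \<G>) (y \<G>)"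
    by metis
  have "\<Inter>\<F> \<noteq> {}"
  proof (cases "card \<F> \<le> card H")
    case True
    then show ?thesis using L(2)[of \<F>] xy[of \<F>] by (auto simp: T_def)
  next
    case False
    show ?thesis
    proof (rule Helly)
      show "DIM('a) + 1 \<le> card \<F>" using False DIM_less_card by simp
      show "\<forall>A\<in>\<F>. convex A" using assms(2) by blast
      fix \<G> assume "\<G> \<subseteq> \<F>" "card \<G> = DIM('a) + 1"
      then have "\<G> \<in> T" using DIM_less_card by (simp add: T_def)
      then show "\<Inter>\<G> \<noteq> {}" using L(2) xy by blast
    qed
  qed
  then obtain p where p: "p \<in> \<Inter>\<F>" by blast
  define Mix where "Mix = {mix T c L | c. (\<forall>\<G>\<in>T. 0 \<le> c \<G>) \<and> sum c T = 1}"
  \<comment> \<open>The index \<open>None\<close> stands for the extra class of convex combinations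
    of the chosen bodies.\<close>
  define \<C> where "\<C> i = (case i of None \<Rightarrow> Mix | Some A \<Rightarrow> {K. body K \<and> K \<subseteq> A})" for i
  have Mix_mix: "mix J b M \<in> Mix"
    if J: "finite J" "\<And>j. j \<in> J \<Longrightarrow> M j \<in> Mix" "\<And>j. j \<in> J \<Longrightarrow> 0 \<le> b j" "sum b J = 1"
    for J :: "'a set option set" and b M
  proof -
    have "\<forall>j\<in>J. \<exists>c. M j = mix T c L \<and> (\<forall>\<G>\<in>T. 0 \<le> c \<G>) \<and> sum c T = 1"
      using J(2) by (auto simp: Mix_def)
    then obtain c where c: "\<And>j. j \<in> J \<Longrightarrow> M j = mix T (c j) L"
      "\<And>j \<G>. j \<in> J \<Longrightarrow> \<G> \<in> T \<Longrightarrow> 0 \<le> c j \<G>" "\<And>j. j \<in> J \<Longrightarrow> sum (c j) T = 1"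
      by metis
    \<comment> \<open>The coefficients of a convex combination of convex combinations.\<close>
    define d where "d \<G> = (\<Sum>j\<in>J. b j * c j \<G>)" for \<G>
    have d0: "0 \<le> d \<G>" if "\<G> \<in> T" for \<G> using that c(2) J(3) by (auto simp: d_def intro!: sum_nonneg)
    have "sum d T = (\<Sum>j\<in>J. \<Sum>\<G>\<in>T. b j * c j \<G>)" unfolding d_def by (rule sum.swap)
    also have "\<dots> = 1" using c(3) J(4) by (simp flip: sum_distrib_left)
    finally have d1: "sum d T = 1" .
    have "mix J b M = mix T d L"
    proof (rule mix_eqI)
      show "body (M j)" if "j \<in> J" for j using that c finT L by (auto intro!: body_mix)
      fix h
      have "(\<Sum>j\<in>J. b j * supp (M j) h) = (\<Sum>j\<in>J. \<Sum>\<G>\<in>T. b j * c j \<G> * supp (L \<G>) h)"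
        using c finT L by (auto simp: supp_mix sum_distrib_left mult.assoc intro!: sum.cong)
      also have "\<dots> = (\<Sum>\<G>\<in>T. d \<G> * supp (L \<G>) h)"
        unfolding d_def sum_distrib_right by (rule sum.swap)
      finally show "(\<Sum>j\<in>J. b j * supp (M j) h) = (\<Sum>\<G>\<in>T. d \<G> * supp (L \<G>) h)" .
    qed (use J finT L d0 in auto)
    then show ?thesis using d0 d1 by (auto simp: Mix_def)
  qed
  have Mix_L: "L \<G> \<in> Mix" if "\<G> \<in> T" for \<G>
  proof -
    define c where "c = (\<lambda>_. 0::real)(\<G> := 1)"
    have c: "\<And>\<G>. 0 \<le> c \<G>" "sum c T = 1"
      using that finT by (auto simp: c_def sum.remove[of T \<G>])
    have "supp (mix T c L) h = supp (L \<G>) h" for h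
      using that finT L c(1) by (simp add: supp_mix) (simp add: c_def sum.remove[of T \<G>])
    then have "L \<G> = mix T c L" using that finT L c(1) by (intro body_eqI body_mix) auto
    then show ?thesis using c by (auto simp: Mix_def)
  qed
  have "\<exists>K. body K \<and> (\<forall>i\<in>insert None (Some ` \<F>). K \<in> \<C> i)"
  proof (rule helly_bodies)
    show "finite (insert None (Some ` \<F>))" using assms(1) by simp
  next
    fix i c M and J :: "'a set option set"
    assume i: "i \<in> insert None (Some ` \<F>)" and J: "finite J" "\<And>j. j \<in> J \<Longrightarrow> M j \<in> \<C> i"
      "\<And>j. j \<in> J \<Longrightarrow> 0 \<le> c j" "sum c J = (1::real)"
    show "mix J c M \<in> \<C> i"
    proof (cases i)
      case None
      then show ?thesis using J Mix_mix by (simp add: \<C>_def)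
    next
      case (Some A)
      then show ?thesis
        using i J assms(2) mix_subset_convex[of A J c M] by (auto simp: \<C>_def intro!: body_mix)
    qed
  next
    fix J assume J: "J \<subseteq> insert None (Some ` \<F>)" "card J \<le> card H + 1"
    have finJ: "finite J" using J(1) assms(1) by (meson finite.insertI finite_imageI finite_subset)
    show "\<exists>K. body K \<and> (\<forall>j\<in>J. K \<in> \<C> j)"
    \<comment> \<open>The index \<open>None\<close> uses up one of the \<open>card H + 1\<close>
      places, so at most \<open>card H\<close> members of the family remain and a chosen body serves
      them all.\<close>
    proof (cases "None \<in> J")
      case True
      define \<G> where "\<G> = {A. Some A \<in> J}"
      have J_eq: "J = insert None (Some ` \<G>)"
        using True unfolding \<G>_def by (intro set_eqI, case_tac x) auto
      have "finite \<G>" using finJ J_eq by (auto simp: finite_image_iff)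
      then have "card J = card \<G> + 1" by (subst J_eq) (auto simp: card_insert_if card_image)
      then have "\<G> \<in> T" using J by (auto simp: T_def \<G>_def)
      then show ?thesis using L Mix_L by (intro exI[of _ "L \<G>"]) (auto simp: J_eq \<C>_def)
    next
      case False
      then show ?thesis using p J(1) body_singleton by (intro exI[of _ "{p}"]) (auto simp: \<C>_def)
    qed
  qed
  then obtain K where K: "body K" "K \<in> Mix" "K \<subseteq> \<Inter>\<F>" by (auto simp: \<C>_def)
  obtain c where c: "K = mix T c L" "\<And>\<G>. \<G> \<in> T \<Longrightarrow> 0 \<le> c \<G>" "sum c T = 1"
    using K(2) by (auto simp: Mix_def)
  have pointed: "\<forall>\<G>\<in>T. a \<G> = 0"
    if a: "\<And>\<G>. \<G> \<in> T \<Longrightarrow> 0 \<le> a \<G>" "\<And>h. h \<in> H \<Longrightarrow> (\<Sum>\<G>\<in>T. a \<G> * supp (L \<G>) h) = 0" for a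
  proof
    fix \<G> assume \<G>: "\<G> \<in> T"
    have "mix T a L = {0}"
      using a finT L body_singleton
      by (intro body_eqI body_mix) (auto simp: supp_mix, simp add: supp_def)
    then have z: "(\<Sum>\<G>'\<in>T. a \<G>' *\<^sub>R z \<G>') = 0" if "\<And>\<G>'. \<G>' \<in> T \<Longrightarrow> z \<G>' \<in> L \<G>'" for z
      using mix_memI[of T z L a] that by blast
    \<comment> \<open>The two selections differ only at \<open>\<G>\<close>, where the points are
      distinct; as both sums vanish, so does the coefficient there.\<close>
    have "(\<Sum>\<G>'\<in>T. a \<G>' *\<^sub>R x \<G>') = 0" "(\<Sum>\<G>'\<in>T. a \<G>' *\<^sub>R (x(\<G> := y \<G>)) \<G>') = 0"
      using xy by (auto intro!: z simp del: fun_upd_apply) (auto)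
    then have "a \<G> *\<^sub>R x \<G> = a \<G> *\<^sub>R y \<G>"
      using \<G> finT by (simp add: sum.remove[of T \<G>] add_eq_0_iff2 del: scaleR_cancel_left)
    then show "a \<G> = 0" using xy[OF \<G>] by auto
  qed
  obtain I b where I: "I \<subseteq> T" "card I \<le> card H" "\<forall>\<G>\<in>I. 0 \<le> b \<G>" "sum c T \<le> sum b I"
    "\<forall>h\<in>H. (\<Sum>\<G>\<in>I. b \<G> * supp (L \<G>) h) = (\<Sum>\<G>\<in>T. c \<G> * supp (L \<G>) h)"
    using caratheodory_cone[OF finite_H finT, of "\<lambda>\<G>. supp (L \<G>)" c] pointed c(2) by blast
  have finI: "finite I" using I(1) finT by (rule finite_subset)
  have "K = mix I b L" unfolding c(1)
    using finI finT L I c(2) by (intro mix_eqI) auto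
  moreover have "\<exists>p\<in>mix I b L. \<exists>q\<in>mix I b L. real (card H) powr (- 1 / 2) \<le> dist p q"
    using finI I c(3) xy by (intro dist_mix_ge[where x=x and y=y]) auto
  ultimately obtain p q where "p \<in> K" "q \<in> K" "real (card H) powr (- 1 / 2) \<le> dist p q" by blast
  then have "ennreal (real (card H) powr (- 1 / 2)) \<le> ediameter K"
    unfolding ediameter_def by (intro SUP_upper2[of "(p, q)"]) (auto intro: ennreal_leI)
  then show ?thesis using K by (auto simp: body_def)
qed

end

theorem theorem3p10:
  fixes H :: "(real ^ 'd) set" and \<F> :: "(real ^ 'd) set set"
  assumes "H \<subseteq> sphere 0 1" and "finite H"
    and "\<And>v. v \<in> sphere 0 1 \<Longrightarrow> \<not> H \<subseteq> closed_half_sphere v"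
    and "minkowski_closed H"
    and "finite \<F>" and "\<And>A. A \<in> \<F> \<Longrightarrow> convex A"
    and "\<And>\<G>. \<G> \<subseteq> \<F> \<Longrightarrow> card \<G> \<le> card H \<Longrightarrow>
           \<exists>K. H_convex H K \<and> K \<subseteq> \<Inter>\<G> \<and> 1 \<le> ediameter K"
  shows "\<exists>K. H_convex H K \<and> K \<subseteq> \<Inter>\<F> \<and>
           ennreal (real (card H) powr (- 1 / 2)) \<le> ediameter K"
proof -
  interpret minkowski_directions H
  proof
    fix v :: "real ^ 'd" assume v: "v \<noteq> 0"
    \<comment> \<open>A direction outside the half-sphere centred opposite to \<open>v\<close> has
      positive inner product with \<open>v\<close>.\<close>
    then have "\<not> H \<subseteq> closed_half_sphere (- v /\<^sub>R norm v)" by (intro assms(3)) auto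
    then obtain h where "h \<in> H" "\<not> 0 \<le> (- v /\<^sub>R norm v) \<bullet> h"
      using assms(1) by (auto simp: closed_half_sphere_def)
    then show "\<exists>h\<in>H. 0 < v \<bullet> h" using v by (auto simp: field_simps intro!: bexI[of _ h])
  qed (use assms in auto)
  show ?thesis using assms(5-7) by (rule helly_diameter)
qed

end
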